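(* Work over $\mathbb{Q}$. Every multilinear polynomial identity of degree 4 satisfied by the tetrad $\{a,b,c,d\}=abcd+dcba$ in every associative algebra is a consequence of the symmetry $\{a,b,c,d\}-\{d,c,b,a\}\equiv 0$.
   Context: A quaternary algebra is a vector space with one quadrilinear operation $\{-,-,-,-\}$. In degree 4, a multilinear polynomial in variables $a,b,c,d$ is a $\mathbb{Q}$-linear combination of the 24 monomials $\{x_1,x_2,x_3,x_4\}$ where $(x_1,\dots,x_4)$ is a permutation of $(a,b,c,d)$. Such a polynomial $I$ is a multilinear identity satisfied by the tetrad if it becomes 0 in the free associative algebra when $\{x_1,x_2,x_3,x_4\}$ is replaced by $x_1x_2x_3x_4+x_4x_3x_2x_1$ (equivalently, $I\equiv 0$ in every associative algebra with the tetrad as operation). An identity $I$ is a consequence of a set $S$ of identities if every quaternary algebra satisfying all identities in $S$ also satisfies $I$; in degree 4 this means $I$ is a linear combination of the polynomials obtained from those of $S$ by permuting the variables. The symbol $\equiv$ means equality for all values of the arguments. *)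

theory Defs
  imports Complex_Main "HOL-Library.Poly_Mapping"
begin

text \<open>A term of type \<open>'a \<Rightarrow>\<^sub>0 rat\<close> is a formal rational linear combination of
  elements of \<open>'a\<close>, so this type is the rational vector space with basis \<open>'a\<close>.\<close>

definition pscale :: "rat \<Rightarrow> ('a \<Rightarrow>\<^sub>0 rat) \<Rightarrow> ('a \<Rightarrow>\<^sub>0 rat)" where
  "pscale r p = Poly_Mapping.map ((*) r) p"

lemma lookup_pscale: "Poly_Mapping.lookup (pscale r p) k = r * Poly_Mapping.lookup p k"
  by (simp add: pscale_def Poly_Mapping.map.rep_eq when_def)

lemma vector_space_pscale: "vector_space pscale"
  by unfold_locales
    (rule poly_mapping_eqI, simp add: lookup_pscale lookup_add algebra_simps)+

subsection \<open>Quaternary algebras over the rationals\<close>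

locale quaternary_algebra = vector_space scale
  for scale :: "rat \<Rightarrow> 'v::ab_group_add \<Rightarrow> 'v" +
  fixes op4 :: "'v \<Rightarrow> 'v \<Rightarrow> 'v \<Rightarrow> 'v \<Rightarrow> 'v"
  assumes linear_arg1: "Vector_Spaces.linear scale scale (\<lambda>x. op4 x y z w)"
    and linear_arg2: "Vector_Spaces.linear scale scale (\<lambda>y. op4 x y z w)"
    and linear_arg3: "Vector_Spaces.linear scale scale (\<lambda>z. op4 x y z w)"
    and linear_arg4: "Vector_Spaces.linear scale scale (\<lambda>w. op4 x y z w)"

subsection \<open>Multilinear polynomials of degree 4\<close>

datatype var = Var_a | Var_b | Var_c | Var_d

text \<open>The quadruple \<open>(x1, x2, x3, x4)\<close> stands for the monomial
  \<open>{x1, x2, x3, x4}\<close>, with a formal operation symbol that satisfies no relations.\<close>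

type_synonym monomial = "var \<times> var \<times> var \<times> var"
type_synonym polynomial = "monomial \<Rightarrow>\<^sub>0 rat"

text \<open>As there are only four variables, distinct entries mean a permutation of them.\<close>

definition multilinear_monomials :: "monomial set" where
  "multilinear_monomials = {(x1, x2, x3, x4). distinct [x1, x2, x3, x4]}"

definition multilinear :: "polynomial \<Rightarrow> bool" where
  "multilinear I \<longleftrightarrow> Poly_Mapping.keys I \<subseteq> multilinear_monomials"

fun eval_monomial :: "('v \<Rightarrow> 'v \<Rightarrow> 'v \<Rightarrow> 'v \<Rightarrow> 'v) \<Rightarrow> (var \<Rightarrow> 'v) \<Rightarrow> monomial \<Rightarrow> 'v" where
  "eval_monomial op4 \<theta> (x1, x2, x3, x4) = op4 (\<theta> x1) (\<theta> x2) (\<theta> x3) (\<theta> x4)"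

definition eval_poly ::
  "(rat \<Rightarrow> 'v::ab_group_add \<Rightarrow> 'v) \<Rightarrow> ('v \<Rightarrow> 'v \<Rightarrow> 'v \<Rightarrow> 'v \<Rightarrow> 'v) \<Rightarrow> (var \<Rightarrow> 'v) \<Rightarrow> polynomial \<Rightarrow> 'v"
  where "eval_poly scale op4 \<theta> I =
    (\<Sum>m\<in>Poly_Mapping.keys I. scale (Poly_Mapping.lookup I m) (eval_monomial op4 \<theta> m))"

definition satisfies ::
  "(rat \<Rightarrow> 'v::ab_group_add \<Rightarrow> 'v) \<Rightarrow> ('v \<Rightarrow> 'v \<Rightarrow> 'v \<Rightarrow> 'v \<Rightarrow> 'v) \<Rightarrow> polynomial \<Rightarrow> bool"
  where "satisfies scale op4 I \<longleftrightarrow> (\<forall>\<theta>. eval_poly scale op4 \<theta> I = 0)"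

subsection \<open>Consequences\<close>

text \<open>HOL cannot quantify over types inside a formula, so the algebras range over all
  structures on the type \<open>'v\<close>; a theorem in which \<open>'v\<close> is a free type variable
  speaks about all quaternary algebras.\<close>

definition consequence :: "'v::ab_group_add itself \<Rightarrow> polynomial set \<Rightarrow> polynomial \<Rightarrow> bool" where
  "consequence TYPE('v) S I \<longleftrightarrow>
    (\<forall>(scale :: rat \<Rightarrow> 'v \<Rightarrow> 'v) op4. quaternary_algebra scale op4 \<longrightarrow>
       (\<forall>J\<in>S. satisfies scale op4 J) \<longrightarrow> satisfies scale op4 I)"

fun rename_monomial :: "(var \<Rightarrow> var) \<Rightarrow> monomial \<Rightarrow> monomial" where
  "rename_monomial \<sigma> (x1, x2, x3, x4) = (\<sigma> x1, \<sigma> x2, \<sigma> x3, \<sigma> x4)"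

definition permute_vars :: "(var \<Rightarrow> var) \<Rightarrow> polynomial \<Rightarrow> polynomial" where
  "permute_vars \<sigma> I =
    (\<Sum>m\<in>Poly_Mapping.keys I. Poly_Mapping.single (rename_monomial \<sigma> m) (Poly_Mapping.lookup I m))"

definition linear_consequence :: "polynomial set \<Rightarrow> polynomial \<Rightarrow> bool" where
  "linear_consequence S I \<longleftrightarrow> I \<in> module.span pscale {permute_vars \<sigma> J | \<sigma> J. bij \<sigma> \<and> J \<in> S}"

subsection \<open>The tetrad\<close>

datatype 'x word = Word (letters: "'x list")

instantiation word :: (type) monoid_add
begin

definition zero_word :: "'x word" where
  "zero_word = Word []"

definition plus_word :: "'x word \<Rightarrow> 'x word \<Rightarrow> 'x word" where
  "plus_word u v = Word (letters u @ letters v)"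

instance
  by standard (simp_all add: zero_word_def plus_word_def)

end

text \<open>Words form the free monoid, written additively because multiplication of
  \<open>'k \<Rightarrow>\<^sub>0 rat\<close> is convolution with respect to addition on \<open>'k\<close>.  Hence
  the following ring is the free associative algebra on \<open>'x\<close>.\<close>

type_synonym 'x free_algebra = "'x word \<Rightarrow>\<^sub>0 rat"

definition generator :: "'x \<Rightarrow> 'x free_algebra" where
  "generator x = Poly_Mapping.single (Word [x]) 1"

definition tetrad :: "'r::ring \<Rightarrow> 'r \<Rightarrow> 'r \<Rightarrow> 'r \<Rightarrow> 'r" where
  "tetrad x y z w = x * y * z * w + w * z * y * x"

text \<open>An identity of the tetrad becomes 0 in the free associative algebra on the variables
  when every monomial \<open>{x1, x2, x3, x4}\<close> is replaced by
  \<open>x1 x2 x3 x4 + x4 x3 x2 x1\<close>.\<close>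

definition tetrad_identity :: "polynomial \<Rightarrow> bool" where
  "tetrad_identity I \<longleftrightarrow>
    eval_poly pscale tetrad (generator :: var \<Rightarrow> var free_algebra) I = 0"

definition symmetry :: polynomial where
  "symmetry = Poly_Mapping.single (Var_a, Var_b, Var_c, Var_d) 1
            - Poly_Mapping.single (Var_d, Var_c, Var_b, Var_a) 1"

end

theory Submission
  imports Defs
begin

text \<open>In the free associative algebra, the coefficient of the word \<open>x1 x2 x3 x4\<close> in
  the image of \<open>I\<close> is the sum of the coefficients in \<open>I\<close> of
  \<open>{x1, x2, x3, x4}\<close> and of its reversal.  So \<open>I\<close> is a tetrad identity iff reversing
  all monomials turns \<open>I\<close> into \<open>-I\<close>, and then
  \<open>I = 1/2 \<Sum> c\<^sub>m (m - reversal of m)\<close>, where each bracket is the symmetry up to a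
  permutation of the variables.\<close>

fun reverse_monomial :: "monomial \<Rightarrow> monomial" where
  "reverse_monomial (x1, x2, x3, x4) = (x4, x3, x2, x1)"

fun word_of_monomial :: "monomial \<Rightarrow> var word" where
  "word_of_monomial (x1, x2, x3, x4) = Word [x1, x2, x3, x4]"

lemma reverse_monomial_reverse [simp]: "reverse_monomial (reverse_monomial m) = m"
  by (cases m) simp

lemma word_of_monomial_eq_iff: "word_of_monomial m = word_of_monomial n \<longleftrightarrow> m = n"
  by (cases m; cases n) auto

lemma reverse_monomial_eq_iff: "reverse_monomial m = n \<longleftrightarrow> m = reverse_monomial n"
  by auto

lemma eval_monomial_tetrad_generator:
  "eval_monomial tetrad generator m =
    Poly_Mapping.single (word_of_monomial m) 1 +
    Poly_Mapping.single (word_of_monomial (reverse_monomial m)) 1"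
  by (cases m) (simp add: tetrad_def generator_def mult_single plus_word_def)

text \<open>A monomial \<open>m\<close> of \<open>I\<close> reaches the word of \<open>n\<close>
  through its own word or through the reversed one. Since reversal is an involution, this leaves
  only \<open>m = n\<close> and \<open>m = reverse_monomial n\<close>; a palindromic
  \<open>n\<close> counts twice on both sides.\<close>

lemma lookup_eval_poly_tetrad:
  "Poly_Mapping.lookup (eval_poly pscale tetrad generator I) (word_of_monomial n) =
    Poly_Mapping.lookup I n + Poly_Mapping.lookup I (reverse_monomial n)"
proof -
  let ?c = "Poly_Mapping.lookup I" and ?K = "Poly_Mapping.keys I"
  have "Poly_Mapping.lookup (eval_poly pscale tetrad generator I) (word_of_monomial n) =
      (\<Sum>m\<in>?K. (?c m when m = n) + (?c m when m = reverse_monomial n))"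
    unfolding eval_poly_def lookup_sum
    by (intro sum.cong refl)
      (simp add: lookup_pscale eval_monomial_tetrad_generator lookup_add lookup_single
        word_of_monomial_eq_iff reverse_monomial_eq_iff when_def)
  \<comment> \<open>If \<open>n\<close> or its reversal is not a key, its sum is empty and its
    coefficient is 0, so the two still agree.\<close>
  also have "\<dots> = ?c n + ?c (reverse_monomial n)"
    by (simp add: sum.distrib when_def in_keys_iff)
  finally show ?thesis .
qed

lemma lookup_reverse_monomial:
  assumes "tetrad_identity I"
  shows "Poly_Mapping.lookup I (reverse_monomial m) = - Poly_Mapping.lookup I m"
  using lookup_eval_poly_tetrad[of I m] assms
  by (simp add: tetrad_identity_def eq_neg_iff_add_eq_0 add.commute)

text \<open>Reversal only negates coefficients, so it preserves the support; this allows sums over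
  the keys to be reindexed.\<close>

lemma bij_betw_reverse_monomial_keys:
  assumes "tetrad_identity I"
  shows "bij_betw reverse_monomial (Poly_Mapping.keys I) (Poly_Mapping.keys I)"
  by (rule bij_betw_byWitness[where f' = reverse_monomial])
    (simp_all add: image_subset_iff in_keys_iff lookup_reverse_monomial[OF assms])

lemma keys_symmetry:
  "Poly_Mapping.keys symmetry = {(Var_a, Var_b, Var_c, Var_d), (Var_d, Var_c, Var_b, Var_a)}"
  by (auto simp: symmetry_def in_keys_iff lookup_minus lookup_single when_def split: if_splits)

lemma eval_poly_symmetry:
  assumes "vector_space scale"
  shows "eval_poly scale op4 \<theta> symmetry =
    op4 (\<theta> Var_a) (\<theta> Var_b) (\<theta> Var_c) (\<theta> Var_d) -
    op4 (\<theta> Var_d) (\<theta> Var_c) (\<theta> Var_b) (\<theta> Var_a)"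
proof -
  interpret vector_space scale by fact
  show ?thesis
    unfolding eval_poly_def keys_symmetry
    by (simp add: symmetry_def lookup_minus lookup_single)
qed

lemma satisfies_symmetryD:
  assumes "vector_space scale" and "satisfies scale op4 symmetry"
  shows "op4 x y z w = op4 w z y x"
proof -
  \<comment> \<open>The assignment sending the four variables to the given arguments turns the
    formal identity into an equation for arbitrary elements.\<close>
  let ?\<theta> = "case_var x y z w"
  have "eval_poly scale op4 ?\<theta> symmetry = 0"
    using assms(2) by (simp add: satisfies_def)
  then show ?thesis
    by (simp add: eval_poly_symmetry[OF assms(1)])
qed

text \<open>Reindexing the value of \<open>I\<close> by reversal keeps the value of each monomial,
  by the symmetry, and negates each coefficient. The value thus equals its own negative.\<close>

lemma tetrad_identity_imp_consequence:
  assumes "tetrad_identity I"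
  shows "consequence TYPE('v::ab_group_add) {symmetry} I"
  unfolding consequence_def satisfies_def[where I = I]
proof (intro allI impI)
  fix scale :: "rat \<Rightarrow> 'v \<Rightarrow> 'v" and op4 and \<theta> :: "var \<Rightarrow> 'v"
  assume "quaternary_algebra scale op4" and S: "\<forall>J\<in>{symmetry}. satisfies scale op4 J"
  then interpret quaternary_algebra scale op4 by simp
  let ?E = "eval_poly scale op4 \<theta> I"
  have rev: "eval_monomial op4 \<theta> (reverse_monomial m) = eval_monomial op4 \<theta> m" for m
    using S by (cases m) (simp add: satisfies_symmetryD[OF vector_space_axioms, of op4])
  have "?E = (\<Sum>m\<in>Poly_Mapping.keys I. scale (Poly_Mapping.lookup I (reverse_monomial m))
      (eval_monomial op4 \<theta> (reverse_monomial m)))"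
    unfolding eval_poly_def
    by (rule sum.reindex_bij_betw[OF bij_betw_reverse_monomial_keys[OF assms], symmetric])
  also have "\<dots> = - ?E"
    by (simp add: eval_poly_def rev lookup_reverse_monomial[OF assms] sum_negf)
  \<comment> \<open>Over the rationals 2 is invertible, so this forces
    \<open>?E = 0\<close>.\<close>
  finally have "scale 2 ?E = 0"
    using scale_left_distrib[of 1 1 ?E] by (simp add: eq_neg_iff_add_eq_0)
  then show "?E = 0"
    by simp
qed

lemma permute_vars_symmetry:
  "permute_vars \<sigma> symmetry =
    Poly_Mapping.single (\<sigma> Var_a, \<sigma> Var_b, \<sigma> Var_c, \<sigma> Var_d) 1 -
    Poly_Mapping.single (\<sigma> Var_d, \<sigma> Var_c, \<sigma> Var_b, \<sigma> Var_a) 1"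
  unfolding permute_vars_def keys_symmetry
  by (simp add: symmetry_def lookup_minus lookup_single single_uminus)

text \<open>The witness sends the variables in order to the entries of \<open>m\<close>. Distinct
  entries make it injective, hence bijective on the finite type \<open>var\<close>.\<close>

lemma ex_bij_permute_vars_symmetry:
  assumes "m \<in> multilinear_monomials"
  shows "\<exists>\<sigma>. bij \<sigma> \<and> permute_vars \<sigma> symmetry =
    Poly_Mapping.single m 1 - Poly_Mapping.single (reverse_monomial m) 1"
proof -
  obtain x1 x2 x3 x4 where m: "m = (x1, x2, x3, x4)" and d: "distinct [x1, x2, x3, x4]"
    using assms by (auto simp: multilinear_monomials_def)
  have "(UNIV :: var set) = {Var_a, Var_b, Var_c, Var_d}"
    using var.exhaust by blast
  then have "finite (UNIV :: var set)"
    by (metis finite.simps)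
  moreover have "inj (case_var x1 x2 x3 x4)"
    using d by (auto intro!: injI split: var.splits)
  ultimately have "bij (case_var x1 x2 x3 x4)"
    by (simp add: bij_def finite_UNIV_inj_surj)
  then show ?thesis
    by (intro exI[of _ "case_var x1 x2 x3 x4"]) (simp add: m permute_vars_symmetry)
qed

text \<open>The factor 1/2 compensates for each coefficient being collected twice: once from
  \<open>m\<close> itself and once, with two cancelling signs, from its reversal.\<close>

lemma tetrad_identity_expansion:
  assumes "tetrad_identity I"
  shows "I = (\<Sum>m\<in>Poly_Mapping.keys I. pscale (Poly_Mapping.lookup I m / 2)
    (Poly_Mapping.single m 1 - Poly_Mapping.single (reverse_monomial m) 1))"
proof (rule poly_mapping_eqI)
  fix n
  let ?c = "Poly_Mapping.lookup I"
  have "Poly_Mapping.lookup (\<Sum>m\<in>Poly_Mapping.keys I. pscale (?c m / 2)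
      (Poly_Mapping.single m 1 - Poly_Mapping.single (reverse_monomial m) 1)) n =
    (\<Sum>m\<in>Poly_Mapping.keys I. (?c m / 2 when m = n) - (?c m / 2 when m = reverse_monomial n))"
    unfolding lookup_sum
    by (intro sum.cong refl)
      (simp add: lookup_pscale lookup_minus lookup_single reverse_monomial_eq_iff when_def)
  also have "\<dots> = ?c n / 2 - ?c (reverse_monomial n) / 2"
    by (simp add: sum_subtractf when_def in_keys_iff)
  also have "\<dots> = ?c n"
    by (simp add: lookup_reverse_monomial[OF assms])
  finally show "?c n = Poly_Mapping.lookup (\<Sum>m\<in>Poly_Mapping.keys I. pscale (?c m / 2)
      (Poly_Mapping.single m 1 - Poly_Mapping.single (reverse_monomial m) 1)) n" ..
qed

lemma tetrad_identity_imp_linear_consequence: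
  assumes "multilinear I" and "tetrad_identity I"
  shows "linear_consequence {symmetry} I"
proof -
  interpret vector_space "pscale :: rat \<Rightarrow> polynomial \<Rightarrow> polynomial"
    by (rule vector_space_pscale)
  let ?G = "{permute_vars \<sigma> J | \<sigma> J. bij \<sigma> \<and> J \<in> {symmetry}}"
  have "Poly_Mapping.single m 1 - Poly_Mapping.single (reverse_monomial m) 1 \<in> ?G"
    if "m \<in> Poly_Mapping.keys I" for m
  proof -
    \<comment> \<open>Multilinearity makes every key a permutation of the variables, so its bracket
      is a renamed copy of the symmetry.\<close>
    have "m \<in> multilinear_monomials"
      using assms(1) that by (auto simp: multilinear_def)
    from ex_bij_permute_vars_symmetry[OF this] show ?thesis
      by force
  qed
  then have "(\<Sum>m\<in>Poly_Mapping.keys I. pscale (Poly_Mapping.lookup I m / 2)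
      (Poly_Mapping.single m 1 - Poly_Mapping.single (reverse_monomial m) 1)) \<in> span ?G"
    by (intro span_sum span_scale span_base)
  then show ?thesis
    unfolding linear_consequence_def using tetrad_identity_expansion[OF assms(2)] by simp
qed

theorem lemma3p1:
  fixes I :: polynomial
  assumes "multilinear I" and "tetrad_identity I"
  shows "consequence TYPE('v::ab_group_add) {symmetry} I \<and> linear_consequence {symmetry} I"
  using tetrad_identity_imp_consequence[OF assms(2)]
    tetrad_identity_imp_linear_consequence[OF assms] by blast

end
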